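(* For any integer $\alpha\ge 0$ and every integer $n\ge 0$: (i) $\overline{R}_6^{\ast}\left(9^{\alpha}n+\frac{9^{\alpha}-1}{4}\right)\equiv \overline{R}_6^{\ast}(n)\pmod 3$; (ii) $\overline{R}_6^{\ast}\left(9^{\alpha+1}n+\frac{21\cdot 9^{\alpha}-1}{4}\right)\equiv 0\pmod 3$; (iii) $\overline{R}_6^{\ast}\left(9^{\alpha+1}n+\frac{33\cdot 9^{\alpha}-1}{4}\right)\equiv 0\pmod 3$.
   Context: An overpartition of a nonnegative integer $n$ is a partition of $n$ in which the first occurrence of each part size may be overlined. For a positive integer $\ell$, $\overline{R}_\ell^{\ast}(n)$ denotes the number of overpartitions of $n$ in which the non-overlined parts are $\ell$-regular, i.e. no non-overlined part is divisible by $\ell$ (overlined parts are unrestricted). With $f_h:=\prod_{m\ge 1}(1-q^{hm})$, the generating function is $\sum_{n\ge 0}\overline{R}_\ell^{\ast}(n)q^n=\frac{f_2f_\ell}{f_1^2}$. *)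

theory Defs
  imports "HOL-Library.Multiset" "HOL-Number_Theory.Cong"
begin

text \<open>
  An overpartition is encoded as a pair \<open>(M, S)\<close>: \<open>M\<close> is the multiset of all parts, overlined
  or not, and \<open>S\<close> is the set of the part sizes whose first occurrence is overlined.
\<close>

definition overpartitions :: "nat \<Rightarrow> (nat multiset \<times> nat set) set" where
  "overpartitions n =
     {(M, S). 0 \<notin># M \<and> sum_mset M = n \<and> S \<subseteq> set_mset M}"

text \<open>Each size in \<open>S\<close> accounts for exactly one overlined copy; the other copies are not overlined.\<close>

definition non_overlined_parts :: "nat multiset \<times> nat set \<Rightarrow> nat multiset" where
  "non_overlined_parts p = fst p - mset_set (snd p)"

definition regular_parts :: "nat \<Rightarrow> nat multiset \<Rightarrow> bool" where
  "regular_parts l M \<longleftrightarrow> (\<forall>m \<in># M. \<not> l dvd m)"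

definition Rbar_star :: "nat \<Rightarrow> nat \<Rightarrow> nat" where
  "Rbar_star l n =
     card {p \<in> overpartitions n. regular_parts l (non_overlined_parts p)}"

text \<open>The set counted above is finite, so that its cardinality is meaningful.\<close>

lemma size_le_sum_mset:
  assumes "0 \<notin># (M :: nat multiset)"
  shows "size M \<le> sum_mset M"
  using assms by (induction M) auto

lemma finite_overpartitions: "finite (overpartitions n)"
proof (rule finite_subset)
  show "overpartitions n \<subseteq>
      (mset ` {xs. set xs \<subseteq> {..n} \<and> length xs \<le> n}) \<times> Pow {..n}"
  proof
    fix p assume "p \<in> overpartitions n"
    then obtain M S where p: "p = (M, S)"
      and M: "0 \<notin># M" "sum_mset M = n" and S: "S \<subseteq> set_mset M"
      by (auto simp: overpartitions_def)
    obtain xs where xs: "M = mset xs"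
      by (metis ex_mset)
    have le: "m \<le> n" if "m \<in># M" for m
      using M(2) sum_mset.remove[OF that] by simp
    have "length xs \<le> n"
      using size_le_sum_mset[OF M(1)] M(2) xs by simp
    moreover have "set xs \<subseteq> {..n}"
      using le xs by auto
    ultimately have "M \<in> mset ` {xs. set xs \<subseteq> {..n} \<and> length xs \<le> n}"
      using xs by blast
    then show "p \<in> (mset ` {xs. set xs \<subseteq> {..n} \<and> length xs \<le> n}) \<times> Pow {..n}"
      using p S le by auto
  qed
  show "finite ((mset ` {xs. set xs \<subseteq> {..n} \<and> length xs \<le> n}) \<times> Pow {..n})"
    by (intro finite_cartesian_product finite_imageI finite_lists_length_le) auto
qed

end

theory Submission
  imports Defs "HOL-Computational_Algebra.Formal_Power_Series"
begin

text \<open>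
  Write \<open>f\<^sub>h\<close> for the product of all \<open>1 - q\<^sup>h\<^sup>m\<close>. The overpartitions in question have generating
  function \<open>f\<^sub>2 f\<^sub>6 / f\<^sub>1\<^sup>2\<close>. Cubing is additive modulo 3, so \<open>f\<^sub>6\<close> is congruent to \<open>f\<^sub>2\<^sup>3\<close> and the
  generating function to the square of \<open>f\<^sub>2\<^sup>2 / f\<^sub>1\<close>. By a theorem of Gauss
  this quotient is the series \<open>\<psi>(q)\<close> of all \<open>q\<close> to a triangular number. Hence, modulo 3,
  \<open>Rbar_star 6 n\<close> is the number of ways to write \<open>n\<close> as an ordered sum of two triangular
  numbers \<open>T\<^sub>a + T\<^sub>b\<close> (\<open>Rbar_star_6_cong\<close>).

  The rest is the fact that 3 is inert in the Gaussian integers, \<open>n = T\<^sub>a + T\<^sub>b\<close> being equivalent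
  to a representation of \<open>4 n + 1\<close> as a sum of two squares. In terms of triangular numbers:
  \<open>T\<^sub>s\<close> is 1 modulo 3 if \<open>s = 3 c + 1\<close>, in which case \<open>T\<^sub>s = 9 T\<^sub>c + 1\<close>, and 0 modulo 3 otherwise.
  A sum of two triangular numbers that is 2 modulo 3 must therefore be 2 modulo 9, and
  the representations of \<open>9 n + 2\<close> correspond to those of \<open>n\<close>, whereas \<open>9 n + 5\<close> and
  \<open>9 n + 8\<close> have none. The arguments in the theorem are the images of \<open>n\<close>, \<open>9 n + 5\<close> and
  \<open>9 n + 8\<close> under the \<open>\<alpha>\<close>-th iterate of \<open>n \<mapsto> 9 n + 2\<close>.

  The proof works with finite products, whose coefficients are compared up to a bound. This suits Gauss's theorem, for which Shanks found a
  finite form with an elementary inductive proof (\<open>shanks_identity\<close>).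
\<close>

section \<open>Power series modulo an integer and a power of the variable\<close>

unbundle fps_syntax

definition fps_cong :: "int \<Rightarrow> nat \<Rightarrow> int fps \<Rightarrow> int fps \<Rightarrow> bool" where
  "fps_cong m N f g \<longleftrightarrow> (\<forall>i\<le>N. [f $ i = g $ i] (mod m))"

lemma fps_cong_refl [simp]: "fps_cong m N f f"
  by (simp add: fps_cong_def)

lemma fps_cong_sym: "fps_cong m N f g \<Longrightarrow> fps_cong m N g f"
  by (simp add: fps_cong_def cong_sym)

lemma fps_cong_trans [trans]: "fps_cong m N f g \<Longrightarrow> fps_cong m N g h \<Longrightarrow> fps_cong m N f h"
  unfolding fps_cong_def by (meson cong_trans)

lemma fps_cong_mult:
  assumes "fps_cong m N f f'" "fps_cong m N g g'"
  shows "fps_cong m N (f * g) (f' * g')"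
  using assms unfolding fps_cong_def fps_mult_nth
  by (auto intro!: cong_sum cong_mult)

lemma fps_cong_add:
  "fps_cong m N f f' \<Longrightarrow> fps_cong m N g g' \<Longrightarrow> fps_cong m N (f + g) (f' + g')"
  by (simp add: fps_cong_def cong_add)

lemma fps_cong_sum:
  "(\<And>x. x \<in> A \<Longrightarrow> fps_cong m N (f x) (g x)) \<Longrightarrow> fps_cong m N (sum f A) (sum g A)"
  by (induction A rule: infinite_finite_induct) (auto intro: fps_cong_add)

lemma fps_cong_power: "fps_cong m N f g \<Longrightarrow> fps_cong m N (f ^ k) (g ^ k)"
  by (induction k) (auto intro: fps_cong_mult)

lemma fps_cong_prod:
  "(\<And>x. x \<in> A \<Longrightarrow> fps_cong m N (f x) (g x)) \<Longrightarrow> fps_cong m N (prod f A) (prod g A)"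
  by (induction A rule: infinite_finite_induct) (auto intro: fps_cong_mult)

text \<open>A series with constant term 1 is invertible over the integers, so it may be cancelled for
  every modulus.\<close>

lemma fps_cong_cancel_left:
  assumes "c $ 0 = 1" "fps_cong m N (c * f) (c * g)"
  shows "fps_cong m N f g"
proof -
  define d where "d = fps_right_inverse c 1"
  have "d * c = 1"
    using fps_right_inverse[of c 1] assms(1) by (simp add: d_def mult.commute)
  moreover have "fps_cong m N (d * (c * f)) (d * (c * g))"
    by (intro fps_cong_mult assms fps_cong_refl)
  ultimately show ?thesis
    by (simp add: mult.assoc [symmetric])
qed

lemma fps_cong_X_power_mult:
  assumes "N < k"
  shows "fps_cong m N (f * fps_X ^ k) 0"
  using assms by (simp add: fps_cong_def fps_X_power_mult_right_nth)

section \<open>Finite Euler products\<close>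

definition euler_prod :: "nat set \<Rightarrow> int fps" where
  "euler_prod A = (\<Prod>i\<in>A. 1 - fps_X ^ i)"

lemma euler_prod_nth_0: "0 \<notin> A \<Longrightarrow> euler_prod A $ 0 = 1"
  unfolding euler_prod_def
  by (induction A rule: infinite_finite_induct) (auto simp: fps_X_power_nth)

lemma euler_prod_truncate:
  assumes "finite B" "A \<subseteq> B" "\<And>i. i \<in> B - A \<Longrightarrow> N < i"
  shows "fps_cong m N (euler_prod B) (euler_prod A)"
proof -
  have one: "fps_cong m N (1 - fps_X ^ i) 1" if "i \<in> B - A" for i
    using assms(3)[OF that] by (simp add: fps_cong_def fps_X_power_nth)
  have "fps_cong m N (euler_prod (B - A)) (\<Prod>i\<in>B - A. 1)"
    unfolding euler_prod_def by (rule fps_cong_prod) (rule one)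
  then have "fps_cong m N (euler_prod A * euler_prod (B - A)) (euler_prod A * 1)"
    by (intro fps_cong_mult) auto
  moreover have "euler_prod B = euler_prod A * euler_prod (B - A)"
    using prod.subset_diff[OF assms(2,1)] by (simp add: euler_prod_def mult.commute)
  ultimately show ?thesis by simp
qed

lemma euler_prod_scaled:
  "k > 0 \<Longrightarrow> euler_prod ((*) k ` A) = (\<Prod>i\<in>A. 1 - fps_X ^ (k * i))"
  unfolding euler_prod_def by (subst prod.reindex) (auto simp: inj_on_def)

section \<open>The generating function of regular overpartitions\<close>

lemma card_pairs_by_sum:
  fixes f :: "'a \<Rightarrow> nat" and g :: "'b \<Rightarrow> nat"
  assumes "\<And>j. finite {x. P x \<and> f x = j}" "\<And>j. finite {y. Q y \<and> g y = j}"
  shows "card {(x, y). P x \<and> Q y \<and> f x + g y = n} =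
    (\<Sum>j=0..n. card {x. P x \<and> f x = j} * card {y. Q y \<and> g y = n - j})"
proof -
  have "{(x, y). P x \<and> Q y \<and> f x + g y = n} =
      (\<Union>j\<in>{0..n}. {x. P x \<and> f x = j} \<times> {y. Q y \<and> g y = n - j})"
    by auto
  also have "card \<dots> = (\<Sum>j=0..n. card ({x. P x \<and> f x = j} \<times> {y. Q y \<and> g y = n - j}))"
    using assms by (intro card_UN_disjoint) auto
  finally show ?thesis by (simp add: card_cartesian_product)
qed

definition mset_gf :: "nat set \<Rightarrow> int fps" where
  "mset_gf A = Abs_fps (\<lambda>n. int (card {M. set_mset M \<subseteq> A \<and> sum_mset M = n}))"

definition subset_gf :: "nat set \<Rightarrow> int fps" where
  "subset_gf A = Abs_fps (\<lambda>n. int (card {S. S \<subseteq> A \<and> \<Sum>S = n}))"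

lemma finite_msets_of_sum:
  fixes A :: "nat set"
  assumes "finite A" "0 \<notin> A"
  shows "finite {M. set_mset M \<subseteq> A \<and> sum_mset M = n}"
proof (rule finite_subset)
  show "{M. set_mset M \<subseteq> A \<and> sum_mset M = n} \<subseteq> mset ` {xs. set xs \<subseteq> A \<and> length xs \<le> n}"
  proof
    fix M assume M: "M \<in> {M. set_mset M \<subseteq> A \<and> sum_mset M = n}"
    obtain xs where "M = mset xs" by (metis ex_mset)
    with M size_le_sum_mset[of M] assms show "M \<in> mset ` {xs. set xs \<subseteq> A \<and> length xs \<le> n}"
      by (auto intro!: imageI)
  qed
qed (use assms in \<open>simp add: finite_lists_length_le\<close>)

text \<open>Removing one copy of a part \<open>a\<close> shows that the partitions that use \<open>a\<close> are counted by
  \<open>fps_X ^ a\<close> times the full generating function; so admitting \<open>a\<close> as a part divides the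
  generating function by \<open>1 - fps_X ^ a\<close>.\<close>

lemma mset_gf_euler_prod:
  assumes "finite A" "0 \<notin> A"
  shows "mset_gf A * euler_prod A = 1"
  using assms
proof (induction A)
  case empty
  have "{M. M = {#} \<and> sum_mset M = n} = (if n = 0 then {{#}} else {})" for n :: nat
    by auto
  then show ?case by (simp add: mset_gf_def euler_prod_def fps_eq_iff)
next
  case (insert a A)
  let ?p = "\<lambda>A n. {M. set_mset M \<subseteq> A \<and> sum_mset M = n}"
  have fin: "finite (?p (insert a A) n)" "finite (?p A n)" for n
    using insert by (auto intro!: finite_msets_of_sum)
  have "mset_gf (insert a A) = mset_gf A + mset_gf (insert a A) * fps_X ^ a"
  proof (rule fps_ext)
    fix n
    have split: "?p (insert a A) n =
        ?p A n \<union> (if n < a then {} else add_mset a ` ?p (insert a A) (n - a))"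
    proof (intro equalityI subsetI)
      fix M assume M: "M \<in> ?p (insert a A) n"
      show "M \<in> ?p A n \<union> (if n < a then {} else add_mset a ` ?p (insert a A) (n - a))"
      proof (cases "a \<in># M")
        case True
        then obtain M' where "M = add_mset a M'" by (metis insert_DiffM)
        with M show ?thesis by (auto intro!: imageI)
      qed (use M in auto)
    qed (auto split: if_splits)
    have disjoint: "?p A n \<inter> add_mset a ` T = {}" for T
      using insert.hyps by auto
    have card_image: "card (add_mset a ` T) = card T" for T
      by (rule card_image) (simp add: inj_on_def)
    have "card (?p (insert a A) n) =
        card (?p A n) + (if n < a then 0 else card (?p (insert a A) (n - a)))"
    proof (cases "n < a")
      case False
      then have "card (?p (insert a A) n) =
          card (?p A n \<union> add_mset a ` ?p (insert a A) (n - a))"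
        using split by presburger
      also have "\<dots> = card (?p A n) + card (add_mset a ` ?p (insert a A) (n - a))"
        by (intro card_Un_disjoint finite_imageI fin disjoint)
      finally show ?thesis using False by (simp only: card_image if_False)
    next
      case True
      then show ?thesis
        using split by (simp only: if_True Un_empty_right add_0_right)
    qed
    then show "mset_gf (insert a A) $ n = (mset_gf A + mset_gf (insert a A) * fps_X ^ a) $ n"
      by (simp add: mset_gf_def fps_X_power_mult_right_nth del: subset_insert_iff)
  qed
  then have "mset_gf (insert a A) * (1 - fps_X ^ a) = mset_gf A"
    by (simp only: right_diff_distrib mult_1_right diff_eq_eq)
  then show ?case
    using insert by (simp add: euler_prod_def mult.assoc [symmetric])
qed

lemma subset_gf_prod:
  assumes "finite A"
  shows "subset_gf A = (\<Prod>a\<in>A. 1 + fps_X ^ a)"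
proof (rule fps_ext)
  fix n
  have "(\<Prod>a\<in>A. 1 + fps_X ^ a) = (\<Sum>S\<in>Pow A. fps_X ^ \<Sum>S :: int fps)"
    using prod_add[OF assms, of "\<lambda>a. fps_X ^ a" "\<lambda>_. 1 :: int fps"]
    by (simp add: add.commute power_sum)
  moreover have "{S \<in> Pow A. n = \<Sum>S} = {S. S \<subseteq> A \<and> \<Sum>S = n}"
    by auto
  ultimately show "subset_gf A $ n = (\<Prod>a\<in>A. 1 + fps_X ^ a) $ n"
    using assms
    by (simp add: subset_gf_def fps_sum_nth sum.If_cases Int_def flip: Pow_iff)
qed

text \<open>An overpartition splits into the set of its overlined parts and the multiset of its other parts,
  and the two can be chosen independently. Parts larger than \<open>n\<close> cannot occur, which makes a
  finite range of parts sufficient.\<close>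

lemma Rbar_star_eq_coeff:
  assumes "n \<le> N"
  shows "int (Rbar_star l n) =
    (subset_gf {1..N} * mset_gf {i \<in> {1..N}. \<not> l dvd i}) $ n"
proof -
  let ?A = "{i \<in> {1..N}. \<not> l dvd i}"
  let ?L = "{p \<in> overpartitions n. regular_parts l (non_overlined_parts p)}"
  let ?P = "{(S, M). S \<subseteq> {1..N} \<and> set_mset M \<subseteq> ?A \<and> \<Sum>S + sum_mset M = n}"
  have "bij_betw (\<lambda>(M, S). (S, M - mset_set S)) ?L ?P"
  proof (rule bij_betw_byWitness[where f' = "\<lambda>(S, M). (M + mset_set S, S)"])
    have fin: "finite S" if "S \<subseteq> set_mset M" for S and M :: "nat multiset"
      using that by (rule finite_subset) simp
    have sub: "mset_set S \<subseteq># M" if "S \<subseteq> set_mset M" for S and M :: "nat multiset"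
      using that mset_set_set_mset_msubset[of M]
      by (meson finite_set_mset fin msubset_mset_set_iff subset_mset.order_trans)
    have sum: "sum_mset (mset_set S) = \<Sum>S" for S :: "nat set"
      by (simp add: sum_unfold_sum_mset)
    show "\<forall>p\<in>?L. (\<lambda>(S, M). (M + mset_set S, S)) ((\<lambda>(M, S). (S, M - mset_set S)) p) = p"
      by (auto simp: overpartitions_def sub)
    show "\<forall>p\<in>?P. (\<lambda>(M, S). (S, M - mset_set S)) ((\<lambda>(S, M). (M + mset_set S, S)) p) = p"
      by auto
    show "(\<lambda>(M, S). (S, M - mset_set S)) ` ?L \<subseteq> ?P"
    proof clarify
      fix M S assume o: "(M, S) \<in> overpartitions n"
        and r: "regular_parts l (non_overlined_parts (M, S))"
      from o have M: "0 \<notin># M" "sum_mset M = n" "S \<subseteq> set_mset M"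
        by (auto simp: overpartitions_def)
      have range: "m \<in> {1..N}" if "m \<in># M" for m
      proof -
        have "m \<noteq> 0" using that M(1) by metis
        moreover have "m \<le> n" using M(2) sum_mset.remove[OF that] by simp
        ultimately show ?thesis using assms by simp
      qed
      have M': "M = (M - mset_set S) + mset_set S" using sub[OF M(3)] by simp
      have "\<Sum>S + sum_mset (M - mset_set S) = n"
        using M(2) arg_cong[OF M', of sum_mset] by (simp add: sum)
      moreover have "set_mset (M - mset_set S) \<subseteq> ?A"
        using r range by (auto simp: regular_parts_def non_overlined_parts_def dest: in_diffD)
      ultimately show "S \<subseteq> {1..N} \<and> set_mset (M - mset_set S) \<subseteq> ?A \<and>
          \<Sum>S + sum_mset (M - mset_set S) = n"
        using M(3) range by blast
    qed
    show "(\<lambda>(S, M). (M + mset_set S, S)) ` ?P \<subseteq> ?L"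
    proof clarify
      fix S M assume *: "S \<subseteq> {1..N}" "set_mset M \<subseteq> ?A" "n = \<Sum>S + sum_mset M"
      have "finite S" using *(1) by (rule finite_subset) simp
      then show "(M + mset_set S, S) \<in> overpartitions (\<Sum>S + sum_mset M) \<and>
          regular_parts l (non_overlined_parts (M + mset_set S, S))"
        using * by (auto simp: overpartitions_def regular_parts_def non_overlined_parts_def sum)
    qed
  qed
  then have "Rbar_star l n = card ?P"
    unfolding Rbar_star_def by (rule bij_betw_same_card)
  also have "\<dots> = (\<Sum>j=0..n. card {S. S \<subseteq> {1..N} \<and> \<Sum>S = j} *
      card {M. set_mset M \<subseteq> ?A \<and> sum_mset M = n - j})"
    by (intro card_pairs_by_sum finite_msets_of_sum) auto
  finally show ?thesis
    by (simp add: subset_gf_def mset_gf_def fps_mult_nth)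
qed

section \<open>Gauss's series of triangular numbers\<close>

definition triangular :: "nat \<Rightarrow> nat" where
  "triangular s = s * (s + 1) div 2"

lemma double_triangular: "2 * triangular s = s * (s + 1)"
  by (simp add: triangular_def)

lemma triangular_double: "triangular (2 * n) = n * (2 * n + 1)"
  by (simp add: triangular_def)

lemma triangular_double_Suc: "triangular (2 * n + 1) = (n + 1) * (2 * n + 1)"
proof -
  have "2 * triangular (2 * n + 1) = 2 * ((n + 1) * (2 * n + 1))"
    unfolding double_triangular by (simp add: algebra_simps)
  then show ?thesis by simp
qed

lemma le_triangular: "a \<le> triangular a"
proof (cases a)
  case (Suc b)
  then have "a * 2 \<le> 2 * triangular a"
    unfolding double_triangular by (intro mult_le_mono) auto
  then show ?thesis by simp
qed simp

text \<open>
  A finite form of Gauss's identity, due to Shanks. Divided by the product on the left,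
  it says that the sum of the first \<open>2 n\<close> powers of \<open>x\<close> to triangular numbers is
  \<open>P\<^sub>n / P\<^sub>s * x\<^bsup>s (2 n + 1)\<^esup>\<close> summed over \<open>s < n\<close>, where \<open>P\<^sub>s\<close> is the product of the quotients
  \<open>(1 - x\<^sup>2\<^sup>i) / (1 - x\<^bsup>2 i - 1\<^esup>)\<close> over \<open>1 \<le> i \<le> s\<close>. In the step from \<open>n\<close> to \<open>n + 1\<close> the left-hand
  side is multiplied by \<open>1 - x\<^bsup>2 n + 1\<^esup>\<close> and gains two powers of \<open>x\<close>. The first of them is the term
  for \<open>s = n\<close> on the right; the second is what remains of the change of the right-hand
  side, which telescopes.
\<close>

lemma shanks_identity:
  fixes x :: "'a :: comm_ring_1"
  shows "(\<Prod>i<n. 1 - x ^ (2 * i + 1)) * (\<Sum>s<2 * n. x ^ triangular s) =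
    (\<Sum>s<n. (\<Prod>i<s. 1 - x ^ (2 * i + 1)) * (\<Prod>i\<in>{s<..n}. 1 - x ^ (2 * i)) * (x ^ (2 * n + 1)) ^ s)"
proof (induction n)
  case (Suc n)
  define y where "y = x ^ (2 * n + 1)"
  define Q where "Q s = (\<Prod>i<s. 1 - x ^ (2 * i + 1))" for s
  define U where "U s = Q s * (\<Prod>i\<in>{s<..n}. 1 - x ^ (2 * i))" for s
  define V where "V s = U s * (1 - x ^ (2 * s + 1)) * y ^ (s + 1)" for s
  have U_n: "U n = Q n" by (simp add: U_def)
  have Q_Suc: "Q (Suc s) = Q s * (1 - x ^ (2 * s + 1))" for s
    by (simp add: Q_def)
  \<comment> \<open>For \<open>s > 0\<close> the summand is \<open>V s - V (s - 1)\<close>, because \<open>U s * (1 - x\<^sup>2\<^sup>s) = U (s - 1) * (1 - x\<^bsup>2 s - 1\<^esup>)\<close>.\<close>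
  have telescope: "(\<Sum>s<Suc k. U s * y ^ s * (y * (1 - x ^ (2 * s + 1)) - (1 - x ^ (2 * s)))) = V k"
    if "k \<le> n" for k
    using that
  proof (induction k)
    case 0
    then show ?case by (simp add: V_def mult_ac)
  next
    case (Suc k)
    have "{k<..n} = insert (Suc k) {Suc k<..n}" using Suc.prems by auto
    then have U_step: "U (Suc k) * (1 - x ^ (2 * Suc k)) = U k * (1 - x ^ (2 * k + 1))"
      by (simp add: U_def Q_Suc mult_ac)
    have "U (Suc k) * y ^ Suc k * (1 - x ^ (2 * Suc k)) =
        (U (Suc k) * (1 - x ^ (2 * Suc k))) * y ^ Suc k"
      by (simp only: mult_ac)
    also have "\<dots> = V k"
      by (simp only: U_step) (simp add: V_def)
    finally have "U (Suc k) * y ^ Suc k * (1 - x ^ (2 * Suc k)) = V k" .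
    moreover have "U (Suc k) * y ^ Suc k * (y * (1 - x ^ (2 * Suc k + 1))) = V (Suc k)"
      unfolding V_def by (simp only: power_Suc Suc_eq_plus1 [symmetric] mult_ac)
    ultimately show ?case
      using Suc by (simp only: sum.lessThan_Suc[of _ "Suc k"] right_diff_distrib) simp
  qed
  have "(\<Sum>s<Suc n. Q s * (\<Prod>i\<in>{s<..Suc n}. 1 - x ^ (2 * i)) * (x ^ (2 * Suc n + 1)) ^ s)
    = (\<Sum>s<Suc n. (1 - y) * (U s * y ^ s) +
       U s * y ^ s * (y * (1 - x ^ (2 * s + 1)) - (1 - x ^ (2 * s))))"
  proof (rule sum.cong)
    fix s assume "s \<in> {..<Suc n}"
    then have "{s<..Suc n} = insert (Suc n) {s<..n}" by auto
    moreover have "x ^ (2 * Suc n) = y * x"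
      by (simp add: y_def mult_ac)
    ultimately have 1: "Q s * (\<Prod>i\<in>{s<..Suc n}. 1 - x ^ (2 * i)) = U s * (1 - y * x)"
      by (simp add: U_def mult_ac)
    have "x ^ (2 * Suc n + 1) = y * x ^ 2"
      by (simp add: y_def power2_eq_square mult_ac)
    then have 2: "(x ^ (2 * Suc n + 1)) ^ s = y ^ s * x ^ (2 * s)"
      by (simp only: power_mult_distrib power_mult)
    have 3: "x ^ (2 * s + 1) = x * x ^ (2 * s)" by simp
    show "Q s * (\<Prod>i\<in>{s<..Suc n}. 1 - x ^ (2 * i)) * (x ^ (2 * Suc n + 1)) ^ s =
      (1 - y) * (U s * y ^ s) + U s * y ^ s * (y * (1 - x ^ (2 * s + 1)) - (1 - x ^ (2 * s)))"
      unfolding 1 2 3 by (simp only: algebra_simps mult_1_left mult_1_right)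
  qed simp
  also have "\<dots> = (1 - y) * (\<Sum>s<Suc n. U s * y ^ s) + V n"
    by (simp only: sum.distrib telescope[OF order_refl] sum_distrib_left)
  also have "(\<Sum>s<Suc n. U s * y ^ s) = Q n * (\<Sum>s<2 * n. x ^ triangular s) + Q n * y ^ n"
    using Suc.IH by (simp add: U_def Q_def y_def)
  also have "(1 - y) * (Q n * (\<Sum>s<2 * n. x ^ triangular s) + Q n * y ^ n) + V n
     = Q (Suc n) * ((\<Sum>s<2 * n. x ^ triangular s) + y ^ n + y ^ (n + 1))"
    by (simp only: V_def U_n Q_Suc y_def [symmetric]) (simp add: algebra_simps)
  also have "(\<Sum>s<2 * n. x ^ triangular s) + y ^ n + y ^ (n + 1) = (\<Sum>s<2 * Suc n. x ^ triangular s)"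
  proof -
    have "y ^ n = x ^ triangular (2 * n)" "y ^ (n + 1) = x ^ triangular (2 * n + 1)"
      unfolding y_def triangular_double triangular_double_Suc
      by (simp_all only: power_mult [symmetric] mult.commute)
    then show ?thesis by simp
  qed
  finally show ?case by (simp add: Q_def)
qed simp

text \<open>In Shanks's identity the term for \<open>s\<close> is divisible by \<open>fps_X ^ ((2 * n + 1) * s)\<close>. So only
  the term for \<open>s = 0\<close> matters up to degree \<open>2 * n\<close>, and that term is the product over the
  even exponents.\<close>

lemma gauss_triangular_series:
  assumes "n > 0"
  shows "fps_cong m (2 * n) ((\<Prod>i<n. 1 - fps_X ^ (2 * i + 1)) * (\<Sum>s<2 * n. fps_X ^ triangular s))
    (euler_prod ((*) 2 ` {1..n}))"
proof -
  obtain n' where n: "n = Suc n'" using assms by (cases n) auto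
  define U :: "nat \<Rightarrow> int fps" where
    "U s = (\<Prod>i<s. 1 - fps_X ^ (2 * i + 1)) * (\<Prod>i\<in>{s<..n}. 1 - fps_X ^ (2 * i))" for s
  have "fps_cong m (2 * n) (\<Sum>s<n'. U (Suc s) * (fps_X ^ (2 * n + 1)) ^ Suc s) (\<Sum>s<n'. 0)"
  proof (rule fps_cong_sum)
    fix s
    have "fps_cong m (2 * n) (U (Suc s) * fps_X ^ ((2 * n + 1) * Suc s)) 0"
      by (rule fps_cong_X_power_mult) simp
    then show "fps_cong m (2 * n) (U (Suc s) * (fps_X ^ (2 * n + 1)) ^ Suc s) 0"
      by (simp only: power_mult)
  qed
  then have "fps_cong m (2 * n) (U 0 + (\<Sum>s<n'. U (Suc s) * (fps_X ^ (2 * n + 1)) ^ Suc s)) (U 0 + 0)"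
    by (intro fps_cong_add) auto
  moreover have "(\<Prod>i<n. 1 - fps_X ^ (2 * i + 1)) * (\<Sum>s<2 * n. fps_X ^ triangular s) =
      U 0 + (\<Sum>s<n'. U (Suc s) * (fps_X ^ (2 * n + 1)) ^ Suc s)"
    unfolding shanks_identity n sum.lessThan_Suc_shift by (simp add: U_def n)
  moreover have "U 0 = euler_prod ((*) 2 ` {1..n})"
    by (simp add: U_def euler_prod_scaled atLeastSucAtMost_greaterThanAtMost)
  ultimately show ?thesis by simp
qed

section \<open>Reduction modulo 3 to sums of two triangular numbers\<close>

lemma euler_prod_cube:
  "fps_cong 3 N (euler_prod ((*) 6 ` A)) (euler_prod ((*) 2 ` A) ^ 3)"
proof -
  have "fps_cong 3 N (1 - fps_X ^ (6 * i)) ((1 - fps_X ^ (2 * i)) ^ 3)" for i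
  proof -
    define Y :: "int fps" where "Y = fps_X ^ (2 * i)"
    have "1 - fps_X ^ (6 * i) = (1 - Y) ^ 3 + 3 * (Y - Y ^ 2)"
      by (simp add: Y_def power_mult [symmetric] algebra_simps power2_eq_square power3_eq_cube
          flip: power_add)
    moreover have "fps_cong 3 N ((1 - Y) ^ 3 + 3 * (Y - Y ^ 2)) ((1 - Y) ^ 3)"
      by (simp add: fps_cong_def cong_iff_dvd_diff numeral_fps_const)
    ultimately show ?thesis by (simp add: Y_def)
  qed
  then show ?thesis
    by (simp add: euler_prod_scaled prod_power_distrib fps_cong_prod)
qed

lemma prod_odd_even:
  fixes f :: "nat \<Rightarrow> 'a :: comm_monoid_mult"
  shows "prod f {1..2 * n} = (\<Prod>i<n. f (2 * i + 1)) * (\<Prod>i\<in>{1..n}. f (2 * i))"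
  by (induction n) (simp_all add: mult_ac)

text \<open>
  In the notation of the proof, \<open>E\<close> and \<open>F\<close> are truncations of \<open>f\<^sub>1\<close> and \<open>f\<^sub>2\<close>. The overlined
  parts contribute \<open>F / E\<close>, and the other parts contribute \<open>f\<^sub>6 / E\<close>, which modulo 3 is \<open>F\<^sup>3 / E\<close>. Since
  Gauss's identity reads \<open>F = Q \<psi>\<close> with \<open>E = Q F\<close>, the product \<open>F\<^sup>4 / E\<^sup>2\<close> is \<open>\<psi>\<^sup>2\<close>. Instead of
  dividing, both sides are multiplied by \<open>E\<^sup>2\<close>, which is cancelled at the end.
\<close>

lemma Rbar_star_6_gf_cong:
  assumes "n > 0"
  shows "fps_cong 3 (2 * n)
    (subset_gf {1..2 * n} * mset_gf {i \<in> {1..2 * n}. \<not> 6 dvd i})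
    ((\<Sum>s<2 * n. fps_X ^ triangular s) ^ 2)"
proof -
  let ?N = "2 * n"
  let ?A = "{i \<in> {1..?N}. \<not> 6 dvd i}" and ?B = "{i \<in> {1..?N}. 6 dvd i}"
  define \<psi> :: "int fps" where "\<psi> = (\<Sum>s<?N. fps_X ^ triangular s)"
  define Q :: "int fps" where "Q = (\<Prod>i<n. 1 - fps_X ^ (2 * i + 1))"
  define E where "E = euler_prod {1..?N}"
  define F where "F = euler_prod ((*) 2 ` {1..n})"
  define R where "R = subset_gf {1..?N} * mset_gf ?A"
  have E_QF: "E = Q * F"
    by (simp add: E_def F_def Q_def euler_prod_scaled)
      (simp only: euler_prod_def prod_odd_even flip: One_nat_def, simp)
  have E_AB: "E = euler_prod ?A * euler_prod ?B"
    unfolding E_def euler_prod_def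
    by (subst prod.union_disjoint [symmetric]) (auto intro!: prod.cong)
  have "fps_cong 3 ?N (subset_gf {1..?N} * E) F"
  proof -
    have "subset_gf {1..?N} * E = (\<Prod>a\<in>{1..?N}. 1 - fps_X ^ (2 * a))"
      unfolding E_def euler_prod_def subset_gf_prod[OF finite_atLeastAtMost] prod.distrib [symmetric]
      by (intro prod.cong refl) (simp add: algebra_simps mult_2 flip: power_add)
    also have "\<dots> = euler_prod ((*) 2 ` {1..?N})"
      by (simp add: euler_prod_scaled)
    also have "fps_cong 3 ?N \<dots> F"
      unfolding F_def by (rule euler_prod_truncate) auto
    finally show ?thesis .
  qed
  moreover have "fps_cong 3 ?N (euler_prod ?B) (F ^ 3)"
  proof -
    have "fps_cong 3 ?N (euler_prod ?B) (euler_prod ((*) 6 ` {1..n}))"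
      by (rule fps_cong_sym, rule euler_prod_truncate) (auto elim!: dvdE)
    also have "fps_cong 3 ?N \<dots> (F ^ 3)"
      unfolding F_def by (rule euler_prod_cube)
    finally show ?thesis .
  qed
  ultimately have "fps_cong 3 ?N (subset_gf {1..?N} * E * euler_prod ?B) (F * F ^ 3)"
    by (rule fps_cong_mult)
  moreover have "E ^ 2 * R = subset_gf {1..?N} * E * euler_prod ?B"
  proof -
    have "E ^ 2 * R = subset_gf {1..?N} * E * (mset_gf ?A * euler_prod ?A) * euler_prod ?B"
      by (simp only: R_def power2_eq_square E_AB mult_ac)
    also have "mset_gf ?A * euler_prod ?A = 1"
      by (rule mset_gf_euler_prod) auto
    finally show ?thesis by simp
  qed
  moreover have "F * F ^ 3 = F ^ 2 * F ^ 2"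
    by (simp flip: power_Suc power_add)
  ultimately have "fps_cong 3 ?N (E ^ 2 * R) (F ^ 2 * F ^ 2)"
    by (simp only:)
  also have "fps_cong 3 ?N \<dots> (F ^ 2 * (Q * \<psi>) ^ 2)"
    unfolding F_def Q_def \<psi>_def
    by (intro fps_cong_mult fps_cong_power fps_cong_refl fps_cong_sym[OF gauss_triangular_series] assms)
  also have "F ^ 2 * (Q * \<psi>) ^ 2 = E ^ 2 * \<psi> ^ 2"
    by (simp add: E_QF power_mult_distrib mult_ac)
  finally have "fps_cong 3 ?N (E ^ 2 * R) (E ^ 2 * \<psi> ^ 2)" .
  moreover have "(E ^ 2) $ 0 = 1"
    by (simp add: E_def euler_prod_nth_0 power2_eq_square fps_mult_nth)
  ultimately show ?thesis
    unfolding R_def \<psi>_def by (rule fps_cong_cancel_left[rotated])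
qed

definition two_triangular_reps :: "nat \<Rightarrow> (nat \<times> nat) set" where
  "two_triangular_reps n = {(a, b). triangular a + triangular b = n}"

lemma psi_square_nth:
  assumes "k < N"
  shows "((\<Sum>s<N. fps_X ^ triangular s) ^ 2 :: int fps) $ k = int (card (two_triangular_reps k))"
proof -
  have "((\<Sum>s<N. fps_X ^ triangular s) ^ 2 :: int fps) =
      (\<Sum>p\<in>{..<N} \<times> {..<N}. fps_X ^ (triangular (fst p) + triangular (snd p)))"
    by (simp add: power2_eq_square sum_product sum.cartesian_product power_add case_prod_unfold)
  moreover have "{p \<in> {..<N} \<times> {..<N}. k = triangular (fst p) + triangular (snd p)} =
      two_triangular_reps k"
  proof -
    have "a < N \<and> b < N" if "triangular a + triangular b = k" for a b
      using that assms le_triangular[of a] le_triangular[of b] by linarith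
    then show ?thesis by (fastforce simp: two_triangular_reps_def)
  qed
  ultimately show ?thesis
    by (simp add: fps_sum_nth sum.If_cases Int_def)
qed

lemma Rbar_star_6_cong:
  "[Rbar_star 6 n = card (two_triangular_reps n)] (mod 3)"
proof -
  have le: "n \<le> 2 * Suc n" "n < 2 * Suc n" by simp_all
  have "[int (Rbar_star 6 n) = int (card (two_triangular_reps n))] (mod 3)"
    unfolding Rbar_star_eq_coeff[OF le(1)] psi_square_nth[OF le(2), symmetric]
    using Rbar_star_6_gf_cong[of "Suc n"] le(1) unfolding fps_cong_def by blast
  then show ?thesis
    by (metis cong_int_iff of_nat_numeral)
qed

section \<open>The action of the prime 3 on sums of two triangular numbers\<close>

lemma triangular_descent: "triangular (3 * a + 1) = 9 * triangular a + 1"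
proof -
  have "2 * triangular (3 * a + 1) = 9 * (2 * triangular a) + 2"
    unfolding double_triangular by (simp add: algebra_simps)
  then show ?thesis by simp
qed

lemma triangular_mod_3: "triangular s mod 3 = (if s mod 3 = 1 then 1 else 0)"
proof -
  define c where "c = s div 3"
  have "s = 3 * c \<or> s = 3 * c + 1 \<or> s = 3 * c + 2"
    unfolding c_def by presburger
  then consider "s = 3 * c" | "s = 3 * c + 1" | "s = 3 * c + 2"
    by blast
  then show ?thesis
  proof cases
    case 1
    then have "2 * triangular s = 3 * (c * s + c)"
      unfolding double_triangular by (simp add: algebra_simps)
    then obtain k where "2 * triangular s = 3 * k" by blast
    then have "triangular s mod 3 = 0" by presburger
    moreover have "s mod 3 \<noteq> 1" using 1 by presburger
    ultimately show ?thesis by simp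
  next
    case 2
    then show ?thesis by (simp only: triangular_descent) presburger
  next
    case 3
    then have "2 * triangular s = 3 * (c * s + s)"
      unfolding double_triangular by (simp add: algebra_simps)
    then obtain k where "2 * triangular s = 3 * k" by blast
    then have "triangular s mod 3 = 0" by presburger
    moreover have "s mod 3 \<noteq> 1" using 3 by presburger
    ultimately show ?thesis by simp
  qed
qed

lemma triangular_sum_mod_3:
  assumes "(triangular a + triangular b) mod 3 = 2"
  obtains c d where "a = 3 * c + 1" "b = 3 * d + 1"
proof -
  have "a mod 3 = 1 \<and> b mod 3 = 1"
    using assms triangular_mod_3[of a] triangular_mod_3[of b] by presburger
  then have "a = 3 * (a div 3) + 1" "b = 3 * (b div 3) + 1"
    by presburger+
  then show ?thesis by (rule that)
qed

lemma two_triangular_reps_descent: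
  "two_triangular_reps (9 * n + 2) = (\<lambda>(a, b). (3 * a + 1, 3 * b + 1)) ` two_triangular_reps n"
proof (intro equalityI subsetI)
  fix p assume p: "p \<in> two_triangular_reps (9 * n + 2)"
  obtain a b where ab: "p = (a, b)" by (cases p)
  with p have sum: "triangular a + triangular b = 9 * n + 2"
    by (simp add: two_triangular_reps_def)
  then have "(triangular a + triangular b) mod 3 = 2" by presburger
  then obtain c d where "a = 3 * c + 1" "b = 3 * d + 1"
    by (rule triangular_sum_mod_3)
  with sum ab show "p \<in> (\<lambda>(a, b). (3 * a + 1, 3 * b + 1)) ` two_triangular_reps n"
    by (auto simp: two_triangular_reps_def triangular_descent intro!: image_eqI[of _ _ "(c, d)"]
        simp del: One_nat_def add_Suc_right)
qed (auto simp: two_triangular_reps_def triangular_descent[unfolded Suc_eq_plus1 [symmetric]])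

text \<open>Such an \<open>n\<close> is 2 modulo 3, which for a sum of two triangular numbers forces 2 modulo 9.\<close>

lemma two_triangular_reps_empty:
  assumes "n mod 9 \<in> {5, 8}"
  shows "two_triangular_reps n = {}"
proof -
  have n: "n mod 9 = 5 \<or> n mod 9 = 8" using assms by simp
  have False if sum: "triangular a + triangular b = n" for a b
  proof -
    have "(triangular a + triangular b) mod 3 = 2"
      unfolding sum using n by presburger
    then obtain c d where "a = 3 * c + 1" "b = 3 * d + 1"
      by (rule triangular_sum_mod_3)
    with sum have "n = 9 * triangular c + 1 + (9 * triangular d + 1)"
      by (simp only: triangular_descent)
    then show False using n by presburger
  qed
  then show ?thesis by (auto simp: two_triangular_reps_def)
qed

lemma nine_power_eq:
  obtains q :: nat where "9 ^ k = 4 * q + 1"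
proof -
  have "\<exists>q :: nat. 9 ^ k = 4 * q + 1"
  proof (induction k)
    case (Suc k)
    then obtain q :: nat where "9 ^ k = 4 * q + 1" by blast
    then have "9 ^ Suc k = 4 * (9 * q + 2) + 1" by simp
    then show ?case by blast
  qed simp
  then show ?thesis using that by blast
qed

lemma card_two_triangular_reps_iterate:
  "card (two_triangular_reps (9 ^ \<alpha> * n + (9 ^ \<alpha> - 1) div 4)) = card (two_triangular_reps n)"
proof (induction \<alpha>)
  case (Suc \<alpha>)
  obtain q :: nat where "9 ^ \<alpha> = 4 * q + 1"
    by (rule nine_power_eq)
  then have "((9 :: nat) ^ Suc \<alpha> - 1) div 4 = 9 * ((9 ^ \<alpha> - 1) div 4) + 2"
    by simp
  then have "9 ^ Suc \<alpha> * n + (9 ^ Suc \<alpha> - 1) div 4 = 9 * (9 ^ \<alpha> * n + (9 ^ \<alpha> - 1) div 4) + 2"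
    by simp
  moreover have "inj_on (\<lambda>(a, b). (3 * a + 1, 3 * b + 1)) S" for S :: "(nat \<times> nat) set"
    by (auto simp: inj_on_def)
  ultimately show ?case
    using Suc by (simp only: two_triangular_reps_descent card_image)
qed simp

theorem theorem3p3:
  fixes \<alpha> n :: nat
  shows "[Rbar_star 6 (9 ^ \<alpha> * n + (9 ^ \<alpha> - 1) div 4) = Rbar_star 6 n] (mod 3)
    \<and> [Rbar_star 6 (9 ^ (\<alpha> + 1) * n + (21 * 9 ^ \<alpha> - 1) div 4) = 0] (mod 3)
    \<and> [Rbar_star 6 (9 ^ (\<alpha> + 1) * n + (33 * 9 ^ \<alpha> - 1) div 4) = 0] (mod 3)"
proof -
  \<comment> \<open>The \<open>\<alpha>\<close>-th iterate of \<open>m \<mapsto> 9 m + 2\<close>.\<close>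
  define e where "e m = 9 ^ \<alpha> * m + (9 ^ \<alpha> - 1) div 4" for m :: nat
  have e_cong: "[Rbar_star 6 (e m) = card (two_triangular_reps m)] (mod 3)" for m
    using Rbar_star_6_cong[of "e m"] by (simp only: e_def card_two_triangular_reps_iterate)
  obtain q :: nat where q: "9 ^ \<alpha> = 4 * q + 1"
    by (rule nine_power_eq)
  have "9 ^ (\<alpha> + 1) * n + (21 * 9 ^ \<alpha> - 1) div 4 = e (9 * n + 5)"
  proof -
    have "(21 * (9 :: nat) ^ \<alpha> - 1) div 4 = 5 * 9 ^ \<alpha> + (9 ^ \<alpha> - 1) div 4"
      using q by simp
    then show ?thesis by (simp add: e_def algebra_simps)
  qed
  moreover have "9 ^ (\<alpha> + 1) * n + (33 * 9 ^ \<alpha> - 1) div 4 = e (9 * n + 8)"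
  proof -
    have "(33 * (9 :: nat) ^ \<alpha> - 1) div 4 = 8 * 9 ^ \<alpha> + (9 ^ \<alpha> - 1) div 4"
      using q by simp
    then show ?thesis by (simp add: e_def algebra_simps)
  qed
  moreover have "[Rbar_star 6 (e n) = Rbar_star 6 n] (mod 3)"
    using e_cong[of n] Rbar_star_6_cong[of n] by (meson cong_sym cong_trans)
  moreover have "[Rbar_star 6 (e (9 * n + 5)) = 0] (mod 3)" "[Rbar_star 6 (e (9 * n + 8)) = 0] (mod 3)"
    using e_cong[of "9 * n + 5"] e_cong[of "9 * n + 8"] by (simp_all add: two_triangular_reps_empty)
  ultimately show ?thesis
    by (simp only: e_def)
qed

end
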